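(* Let $(\mathcal{X},d)$ be a complete metric space, let $f\colon\mathcal{X}\to\mathbb{R}\cup\{+\infty\}$ be a closed function, and let $x\in\mathcal{X}$ be a point with $f(x)$ finite. Let $f_x\colon\mathcal{X}\to\mathbb{R}\cup\{+\infty\}$ be a closed function such that $$|f_x(y)-f(y)|\leq\omega(d(x,y))\quad\text{for all } y\in\mathcal{X},$$ where $\omega$ is some growth function. Define the model improvement $\Delta_x:=f(x)-\inf f_x$. Then for any constant $c>0$, there exist two points $z,\hat x\in\mathcal{X}$ satisfying 1. (point proximity) $d(x,z)\leq c^{-1}\sqrt{\Delta_x}$ and $d(z,\hat x)\leq 2\cdot\frac{\omega(d(z,x))}{\omega'(d(z,x))}$, under the convention $\frac00=0$, 2. (value proximity) $f(\hat x)\leq f(x)+2\omega(d(z,x))$, 3. (near-stationarity) $|\nabla f|(\hat x)\leq c\sqrt{\Delta_x}+\omega'(d(z,x))+\omega'(d(\hat x,x))$.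
   Context: A function on a metric space is called closed if it is lower-semicontinuous. A growth function is a differentiable function $\omega\colon[0,\infty)\to[0,\infty)$ (one-sided derivative at $0$) with $\omega(0)=\omega'(0)=0$ and $\omega'>0$ on $(0,\infty)$. The slope of $f$ at a point $\bar x$ with $f(\bar x)$ finite is $|\nabla f|(\bar x):=\limsup_{x\to\bar x,\,x\ne\bar x}\frac{(f(\bar x)-f(x))^+}{d(\bar x,x)}$, where $r^+=\max\{0,r\}$ (it is $0$ if $\bar x$ is isolated); by convention $|\nabla f|(\bar x)=+\infty$ where $f(\bar x)=+\infty$. The inequality $|f_x(y)-f(y)|\le\omega(d(x,y))$ is understood to mean that $f_x(y)$ and $f(y)$ are either both $+\infty$ or both finite and satisfying the inequality. Note $\Delta_x\in[0,+\infty]$. *)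

theory Defs
  imports "HOL-Analysis.Analysis"
begin

(* At an isolated point the punctured Liminf is \<infinity>, so the condition is vacuous there. *)
definition lower_semicontinuous :: "('a::topological_space \<Rightarrow> ereal) \<Rightarrow> bool" where
  "lower_semicontinuous f \<longleftrightarrow> (\<forall>x. f x \<le> Liminf (at x) f)"

(* Functions with values in the reals extended by +\<infinity> are ereal-valued functions omitting -\<infinity>. *)
definition closed_function :: "('a::metric_space \<Rightarrow> ereal) \<Rightarrow> bool" where
  "closed_function f \<longleftrightarrow> (\<forall>x. f x \<noteq> -\<infinity>) \<and> lower_semicontinuous f"

(* Only the values on {0..} matter. There the derivative \<omega>' is determined by \<omega>; at 0 it is the
   right derivative, because of the restriction to {0..}. *)
definition growth_function :: "(real \<Rightarrow> real) \<Rightarrow> (real \<Rightarrow> real) \<Rightarrow> bool" where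
  "growth_function \<omega> \<omega>' \<longleftrightarrow>
     (\<forall>t\<ge>0. 0 \<le> \<omega> t) \<and>
     (\<forall>t\<ge>0. (\<omega> has_real_derivative \<omega>' t) (at t within {0..})) \<and>
     \<omega> 0 = 0 \<and> \<omega>' 0 = 0 \<and> (\<forall>t>0. 0 < \<omega>' t)"

(* "at x = bot" says that x is isolated; Limsup along bot would be -\<infinity> instead of 0. *)
definition slope :: "('a::metric_space \<Rightarrow> ereal) \<Rightarrow> 'a \<Rightarrow> ereal" where
  "slope f x =
     (if f x = \<infinity> then \<infinity>
      else if at x = bot then 0
      else Limsup (at x) (\<lambda>y. max 0 (f x - f y) / ereal (dist x y)))"

(* The inequality \<bar>g y - f y\<bar> \<le> \<omega> (d x y), where common infinite values are allowed. *)
definition model_at ::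
  "(real \<Rightarrow> real) \<Rightarrow> ('a::metric_space \<Rightarrow> ereal) \<Rightarrow> 'a \<Rightarrow> ('a \<Rightarrow> ereal) \<Rightarrow> bool" where
  "model_at \<omega> f x g \<longleftrightarrow>
     (\<forall>y. (g y = \<infinity> \<and> f y = \<infinity>) \<or>
          (\<bar>g y\<bar> \<noteq> \<infinity> \<and> \<bar>f y\<bar> \<noteq> \<infinity> \<and> \<bar>g y - f y\<bar> \<le> ereal (\<omega> (dist x y))))"

definition model_improvement :: "('a \<Rightarrow> ereal) \<Rightarrow> 'a \<Rightarrow> ('a \<Rightarrow> ereal) \<Rightarrow> ereal" where
  "model_improvement f x g = f x - (INF y. g y)"

(* Square root on [0, \<infinity>]. *)
definition ereal_sqrt :: "ereal \<Rightarrow> ereal" where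
  "ereal_sqrt r = (if r = \<infinity> then \<infinity> else ereal (sqrt (real_of_ereal r)))"

end

(* Apply the Ekeland variational principle twice. On f_x, starting at x, it yields z, which minimizes
   f_x + c sqrt(\<Delta>) d(z, -). Starting at z, apply it to the upper model
   g = f + \<omega>(d(x, -)) + c sqrt(\<Delta>) d(z, -): this lies above f_x + c sqrt(\<Delta>) d(z, -), so that
   g(z) - inf g \<le> 2 \<omega>(d(x, z)), and with parameter \<omega>'(d(x, z)) one obtains xhat. The slope of f at
   xhat is then bounded by the Ekeland parameter plus the local Lipschitz constants of the two
   terms added to f. If \<Delta> is infinite, z = xhat = x will do. *)
theory Submission
  imports Defs
begin

section \<open>Lower semicontinuity of extended real-valued functions\<close>

lemma lower_semicontinuous_eventually:
  assumes "lower_semicontinuous h" "r < h x"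
  shows "\<forall>\<^sub>F y in nhds x. r < h y"
proof -
  have "h x \<le> Liminf (at x) h" using assms(1) by (simp add: lower_semicontinuous_def)
  then have "\<forall>\<^sub>F y in at x. r < h y" using assms(2) by (simp add: le_Liminf_iff)
  then show ?thesis using assms(2) by (simp add: eventually_nhds_conv_at)
qed

text \<open>A value strictly between \<open>B\<close> and \<open>h z\<close> would eventually
  separate \<open>h (X n)\<close> from \<open>b n\<close>. This is what places the limit of the
  Ekeland iterates in every set \<open>S (X k)\<close>.\<close>

lemma lower_semicontinuous_limit_le:
  fixes b :: "nat \<Rightarrow> ereal"
  assumes "lower_semicontinuous h" "X \<longlonglongrightarrow> z" "b \<longlonglongrightarrow> B"
    and "\<forall>\<^sub>F n in sequentially. h (X n) \<le> b n"
  shows "h z \<le> B"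
proof (rule ccontr)
  assume "\<not> h z \<le> B"
  then obtain r where r: "B < r" "r < h z" using dense not_le by metis
  have "\<forall>\<^sub>F n in sequentially. r < h (X n)"
    using lower_semicontinuous_eventually[OF assms(1) r(2)] assms(2)
    by (rule eventually_compose_filterlim)
  moreover have "\<forall>\<^sub>F n in sequentially. b n < r"
    using assms(3) r(1) by (rule order_tendstoD)
  ultimately have "\<forall>\<^sub>F n::nat in sequentially. False"
    using assms(4) by eventually_elim auto
  then show False by simp
qed

lemma lower_semicontinuous_add_continuous:
  fixes h :: "'a::metric_space \<Rightarrow> ereal"
  assumes "lower_semicontinuous h" "continuous_on UNIV k"
  shows "lower_semicontinuous (\<lambda>y. h y + ereal (k y))"
  unfolding lower_semicontinuous_def le_Liminf_iff
proof (intro allI impI)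
  fix x r assume "r < h x + ereal (k x)"
  then have "r - ereal (k x) < h x"
    by (simp add: ereal_minus_less)
  \<comment> \<open>A finite threshold splits the strict inequality: near \<open>x\<close>,
    \<open>h\<close> stays above \<open>q\<close> by semicontinuity and \<open>q + k\<close> stays
    above \<open>r\<close> by continuity.\<close>
  then obtain q where q: "r - ereal (k x) < ereal q" "ereal q < h x"
    using ereal_dense2 by metis
  have "(k \<longlongrightarrow> k x) (at x)"
    using assms(2) by (simp add: continuous_on_def)
  then have lim: "((\<lambda>y. ereal q + ereal (k y)) \<longlongrightarrow> ereal q + ereal (k x)) (at x)"
    by (auto intro!: tendsto_intros)
  have "r < ereal q + ereal (k x)" using q(1) by (simp add: ereal_minus_less)
  then have "\<forall>\<^sub>F y in at x. r < ereal q + ereal (k y)"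
    using lim order_tendstoD(1) by blast
  moreover have "\<forall>\<^sub>F y in at x. ereal q < h y"
    using lower_semicontinuous_eventually[of h "ereal q" x] assms(1) q(2)
    by (simp add: eventually_nhds_conv_at)
  ultimately show "\<forall>\<^sub>F y in at x. r < h y + ereal (k y)"
  proof eventually_elim
    case (elim y)
    then show ?case
      by (meson add_right_mono less_imp_le less_le_trans)
  qed
qed

section \<open>Ekeland's variational principle\<close>

theorem Ekeland_variational_principle:
  fixes h :: "'a::complete_space \<Rightarrow> ereal"
  assumes lsc: "lower_semicontinuous h" and fin: "h x \<noteq> \<infinity>"
    and bound: "\<And>y. ereal m \<le> h y" and pos: "0 < \<kappa>"
  shows "\<exists>z. h z + ereal (\<kappa> * dist x z) \<le> h x \<and>
             (\<forall>y. y \<noteq> z \<longrightarrow> h z < h y + ereal (\<kappa> * dist z y))"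
proof -
  \<comment> \<open>Moving from \<open>u\<close> into \<open>S u\<close> pays for the distance by a
    decrease of \<open>h\<close>. These are the down-sets of the Ekeland order, and the strict
    inequality sought says that \<open>S z\<close> contains only \<open>z\<close>. So
    \<open>z\<close> is found as the limit of nested sets with diameters tending to 0.\<close>
  define S where "S u = {y. h y + ereal (\<kappa> * dist u y) \<le> h u}" for u
  have real: "\<exists>a. h y = ereal a" if "h y \<noteq> \<infinity>" for y
    using bound[of y] that by (cases "h y") auto
  have S_refl: "u \<in> S u" for u by (simp add: S_def)
  have S_fin: "h v \<noteq> \<infinity>" if "v \<in> S u" "h u \<noteq> \<infinity>" for u v
    using that by (auto simp: S_def)
  have S_trans: "y \<in> S u" if "v \<in> S u" "y \<in> S v" for u v y
  proof -
    have "\<kappa> * dist u y \<le> \<kappa> * dist u v + \<kappa> * dist v y"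
      using pos dist_triangle[of u y v] by (simp flip: distrib_left)
    then show ?thesis
      using that unfolding S_def
      by (cases "h u"; cases "h v"; cases "h y") auto
  qed
  have step: "\<exists>v\<in>S u. \<forall>y\<in>S u. h v \<le> h y + ereal ((1/2) ^ n)" if "h u \<noteq> \<infinity>" for u and n :: nat
  proof -
    let ?I = "INF y\<in>S u. h y"
    have "ereal m \<le> ?I" by (intro INF_greatest bound)
    moreover have "?I \<le> h u" by (intro INF_lower S_refl)
    ultimately have "\<bar>?I\<bar> \<noteq> \<infinity>" using that by auto
    then have "?I < ?I + ereal ((1/2) ^ n)" by (cases ?I) auto
    then obtain v where "v \<in> S u" "h v < ?I + ereal ((1/2) ^ n)"
      by (auto simp: INF_less_iff)
    then show ?thesis
      by (meson INF_lower add_right_mono less_imp_le order_trans)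
  qed
  have "\<exists>X. \<forall>n. (h (X n) \<noteq> \<infinity> \<and> (n = 0 \<longrightarrow> X n = x)) \<and>
      (X (Suc n) \<in> S (X n) \<and> (\<forall>y\<in>S (X n). h (X (Suc n)) \<le> h y + ereal ((1/2) ^ n)))"
    by (rule dependent_nat_choice) (use fin step S_fin in blast)+
  then obtain X where X_fin: "\<And>n. h (X n) \<noteq> \<infinity>" and X0: "X 0 = x"
    and X_Suc: "\<And>n. X (Suc n) \<in> S (X n)"
    and X_min: "\<And>n y. y \<in> S (X n) \<Longrightarrow> h (X (Suc n)) \<le> h y + ereal ((1/2) ^ n)"
    by metis
  have X_mem: "X n \<in> S (X k)" if "k \<le> n" for k n
    using that by (induction rule: dec_induct) (auto intro: S_refl S_trans X_Suc)
  \<comment> \<open>Near-minimality of \<open>X (Suc n)\<close> over the larger set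
    \<open>S (X n)\<close> allows a further decrease of at most \<open>(1/2) ^ n\<close>, while
    membership of \<open>y\<close> demands at least \<open>\<kappa>\<close> times the
    distance.\<close>
  have close: "dist (X (Suc n)) y \<le> (1/2) ^ n / \<kappa>" if "y \<in> S (X (Suc n))" for n y
  proof -
    have "h (X (Suc n)) \<le> h y + ereal ((1/2) ^ n)"
      using X_min S_trans[OF X_Suc that] by blast
    moreover have "h y + ereal (\<kappa> * dist (X (Suc n)) y) \<le> h (X (Suc n))"
      using that by (simp add: S_def)
    ultimately have "\<kappa> * dist (X (Suc n)) y \<le> (1/2) ^ n"
      using real[OF X_fin[of "Suc n"]] real[OF S_fin[OF that X_fin]] by auto
    then show ?thesis using pos by (simp add: field_simps)
  qed
  have geometric: "(\<lambda>n. (1/2) ^ n / \<kappa>) \<longlonglongrightarrow> 0"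
    by (intro tendsto_divide_zero LIMSEQ_realpow_zero) auto
  have "Cauchy X"
    unfolding Cauchy_altdef2
  proof (intro allI impI)
    fix e :: real assume "0 < e"
    then obtain n where "(1/2) ^ n / \<kappa> < e"
      using order_tendstoD(2)[OF geometric] eventually_sequentially by force
    then have "\<forall>k\<ge>Suc n. dist (X k) (X (Suc n)) < e"
      using close[OF X_mem, of n] by (metis dist_commute le_less_trans)
    then show "\<exists>N. \<forall>n\<ge>N. dist (X n) (X N) < e" by blast
  qed
  then obtain z where z: "X \<longlonglongrightarrow> z"
    using Cauchy_convergent_iff convergent_def by blast
  have z_mem: "z \<in> S (X k)" for k
  proof -
    obtain a where a: "h (X k) = ereal a" using real X_fin by blast
    \<comment> \<open>With \<open>h (X k)\<close> real, the distance term can move to the right,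
      where it is continuous in the moving point.\<close>
    have "h z \<le> ereal (a - \<kappa> * dist (X k) z)"
    proof (rule lower_semicontinuous_limit_le[OF lsc z])
      show "(\<lambda>n. ereal (a - \<kappa> * dist (X k) (X n))) \<longlonglongrightarrow> ereal (a - \<kappa> * dist (X k) z)"
        by (intro tendsto_intros z)
      have "h (X n) \<le> ereal (a - \<kappa> * dist (X k) (X n))" if "k \<le> n" for n
        using X_mem[OF that] a by (cases "h (X n)") (auto simp: S_def)
      then show "\<forall>\<^sub>F n in sequentially. h (X n) \<le> ereal (a - \<kappa> * dist (X k) (X n))"
        using eventually_sequentially by blast
    qed
    then show ?thesis using a by (cases "h z") (auto simp: S_def)
  qed
  \<comment> \<open>A competitor violating this lies in \<open>S z\<close>, hence in every
    \<open>S (X n)\<close>, and so is itself a limit of \<open>X\<close>.\<close>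
  have "h z < h y + ereal (\<kappa> * dist z y)" if "y \<noteq> z" for y
  proof (rule ccontr)
    assume "\<not> h z < h y + ereal (\<kappa> * dist z y)"
    then have "y \<in> S z" by (simp add: S_def)
    then have "dist (X (Suc n)) y \<le> (1/2) ^ n / \<kappa>" for n
      using close S_trans z_mem by blast
    then have "(\<lambda>n. dist (X (Suc n)) y) \<longlonglongrightarrow> 0"
      by (intro tendsto_sandwich[OF _ _ tendsto_const geometric]) auto
    then have "(\<lambda>n. X (Suc n)) \<longlonglongrightarrow> y" by (subst tendsto_dist_iff)
    then show False using LIMSEQ_unique LIMSEQ_Suc[OF z] that by blast
  qed
  then show ?thesis using z_mem[of 0] X0 by (auto simp: S_def)
qed

text \<open>Since \<open>\<epsilon> / 0 = 0\<close>, the radius is also right in the degenerate case, where \<open>x\<close> is a minimizer.\<close>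
lemma Ekeland_near_minimizer:
  fixes h :: "'a::complete_space \<Rightarrow> ereal"
  assumes lsc: "lower_semicontinuous h" and bound: "\<And>y. ereal m \<le> h y"
    and near: "h x \<le> ereal (m + \<epsilon>)" and "0 \<le> \<kappa>" "\<kappa> = 0 \<Longrightarrow> \<epsilon> = 0"
  obtains z where "dist x z \<le> \<epsilon> / \<kappa>" "h z \<le> h x"
    "\<forall>y. h z \<le> h y + ereal (\<kappa> * dist z y)"
proof (cases "\<kappa> = 0")
  case True
  have "h x \<le> h y" for y using near bound[of y] True assms(5) by auto
  then show ?thesis using that[of x] True by auto
next
  case False
  then have pos: "0 < \<kappa>" using assms(4) by simp
  have "h x \<noteq> \<infinity>" using near by auto
  then obtain z where z: "h z + ereal (\<kappa> * dist x z) \<le> h x"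
    and strict: "\<And>y. y \<noteq> z \<Longrightarrow> h z < h y + ereal (\<kappa> * dist z y)"
    using Ekeland_variational_principle[OF lsc _ bound pos] by blast
  have "\<kappa> * dist x z \<le> \<epsilon>"
    using z near bound[of z] by (cases "h z"; cases "h x") auto
  then have "dist x z \<le> \<epsilon> / \<kappa>" using pos by (simp add: field_simps)
  moreover have "h z \<le> h x"
    using z pos by (cases "h z"; cases "h x") (auto intro: order_trans[rotated])
  moreover have "h z \<le> h y + ereal (\<kappa> * dist z y)" for y
    using strict[of y] by (cases "y = z") auto
  ultimately show ?thesis using that by blast
qed

section \<open>Slope bounds and growth functions of the distance\<close>

lemma slope_le:
  fixes f :: "'a::metric_space \<Rightarrow> ereal"
  assumes "\<bar>f x\<bar> \<noteq> \<infinity>" "0 \<le> L"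
    and lower: "\<And>e. 0 < e \<Longrightarrow> \<forall>\<^sub>F y in at x. f x \<le> f y + ereal ((L + e) * dist x y)"
  shows "slope f x \<le> ereal L"
proof (cases "at x = bot")
  case True
  then show ?thesis using assms by (auto simp: slope_def)
next
  case False
  have "Limsup (at x) (\<lambda>y. max 0 (f x - f y) / ereal (dist x y)) \<le> ereal L"
  \<comment> \<open>The slack \<open>e\<close> is needed because a derivative at a single point
    gives a local Lipschitz constant only up to an arbitrarily small error.\<close>
  proof (rule ereal_le_epsilon2)
    fix e :: real assume e: "0 < e"
    have "\<forall>\<^sub>F y in at x. max 0 (f x - f y) / ereal (dist x y) \<le> ereal (L + e)"
      using lower[OF e] eventually_neq_at_within[of x x UNIV]
    proof eventually_elim
      case (elim y)
      have d: "0 < dist x y" using elim by simp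
      \<comment> \<open>Nonnegativity of the bound lets it dominate the positive part as well,
        including where \<open>f y\<close> is infinite.\<close>
      have "0 \<le> (L + e) * dist x y" using assms(2) e by simp
      then have "max 0 (f x - f y) \<le> ereal ((L + e) * dist x y)"
        using elim(1) assms(1) by (cases "f x"; cases "f y") (auto simp: max_def)
      then show ?case using d
        by (simp add: ereal_divide_le_pos mult.commute)
    qed
    then show "Limsup (at x) (\<lambda>y. max 0 (f x - f y) / ereal (dist x y)) \<le> ereal L + ereal e"
      by (simp add: Limsup_bounded)
  qed
  then show ?thesis using assms(1) False by (auto simp: slope_def)
qed

lemma growth_function_nonneg:
  assumes "growth_function \<omega> \<omega>'" "0 \<le> t"
  shows "0 \<le> \<omega> t" "0 \<le> \<omega>' t"
  using assms by (auto simp: growth_function_def less_eq_real_def)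

text \<open>The distance to \<open>x\<close> is 1-Lipschitz but need not be differentiable, so a
  first-order estimate for \<open>\<omega>\<close> replaces the chain rule. The one-sided derivative
  suffices at \<open>y0 = x\<close>, since distances are nonnegative.\<close>

lemma growth_function_dist_increment:
  fixes x y0 :: "'a::metric_space"
  assumes "growth_function \<omega> \<omega>'" "0 < e"
  shows "\<forall>\<^sub>F y in at y0. \<bar>\<omega> (dist x y) - \<omega> (dist x y0)\<bar> \<le> (\<omega>' (dist x y0) + e) * dist y0 y"
proof -
  let ?s = "dist x y0"
  have "(\<omega> has_derivative (*) (\<omega>' ?s)) (at ?s within {0..})"
    using assms(1) by (auto simp: growth_function_def has_field_derivative_def)
  then obtain d where d: "0 < d" and *: "\<And>t. 0 \<le> t \<Longrightarrow> \<bar>t - ?s\<bar> < d \<Longrightarrow>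
      \<bar>\<omega> t - \<omega> ?s - \<omega>' ?s * (t - ?s)\<bar> \<le> e * \<bar>t - ?s\<bar>"
    using assms(2) unfolding has_derivative_within_alt by (fastforce simp: real_norm_def)
  show ?thesis
    unfolding eventually_at
  proof (intro exI[of _ d] conjI ballI impI)
    fix y assume y: "y \<noteq> y0 \<and> dist y y0 < d"
    have tri: "\<bar>dist x y - ?s\<bar> \<le> dist y0 y"
      by (metis abs_dist_diff_le dist_commute)
    then have "\<bar>\<omega> (dist x y) - \<omega> ?s - \<omega>' ?s * (dist x y - ?s)\<bar> \<le> e * \<bar>dist x y - ?s\<bar>"
      using y by (intro *) (auto simp: dist_commute)
    then have "\<bar>\<omega> (dist x y) - \<omega> ?s\<bar> \<le> \<bar>\<omega>' ?s * (dist x y - ?s)\<bar> + e * \<bar>dist x y - ?s\<bar>"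
      by linarith
    also have "\<dots> = (\<omega>' ?s + e) * \<bar>dist x y - ?s\<bar>"
      using growth_function_nonneg(2)[OF assms(1), of ?s] by (simp add: abs_mult distrib_right)
    also have "\<dots> \<le> (\<omega>' ?s + e) * dist y0 y"
      using tri growth_function_nonneg(2)[OF assms(1), of ?s] assms(2)
      by (intro mult_left_mono) auto
    finally show "\<bar>\<omega> (dist x y) - \<omega> ?s\<bar> \<le> (\<omega>' ?s + e) * dist y0 y" .
  qed (rule d)
qed

lemma growth_function_dist_continuous:
  assumes "growth_function \<omega> \<omega>'"
  shows "continuous_on UNIV (\<lambda>y. \<omega> (dist x y))"
proof -
  have "continuous_on {0..} \<omega>"
    using assms unfolding growth_function_def
    by (auto intro!: DERIV_continuous_on)
  then show ?thesis
    by (rule continuous_on_compose2) (auto intro!: continuous_intros)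
qed

section \<open>The two applications of the variational principle\<close>

lemma near_stationary_point_of_model_minimizer:
  fixes f g :: "'a::complete_space \<Rightarrow> ereal"
  assumes f: "lower_semicontinuous f" and growth: "growth_function \<omega> \<omega>'"
    and model: "model_at \<omega> f x g" and fin: "g z \<noteq> \<infinity>" and C: "0 \<le> C"
    and min: "\<And>y. g z \<le> g y + ereal (C * dist z y)"
  obtains y where "dist z y \<le> 2 * (\<omega> (dist x z) / \<omega>' (dist x z))"
    "f y \<le> f z + ereal (\<omega> (dist x z))"
    "slope f y \<le> ereal (C + \<omega>' (dist x z) + \<omega>' (dist x y))"
proof -
  define G where "G y = f y + ereal (\<omega> (dist x y) + C * dist z y)" for y
  have model_cases: "(\<exists>a b. g y = ereal a \<and> f y = ereal b \<and> \<bar>a - b\<bar> \<le> \<omega> (dist x y)) \<or>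
      g y = \<infinity> \<and> f y = \<infinity>" for y
    using model unfolding model_at_def by (cases "g y"; cases "f y") (force dest: spec[of _ y])+
  obtain m b where m: "g z = ereal m" and b: "f z = ereal b" "\<bar>m - b\<bar> \<le> \<omega> (dist x z)"
    using model_cases[of z] fin by auto
  have "lower_semicontinuous G"
    unfolding G_def
    by (intro lower_semicontinuous_add_continuous f continuous_intros
        growth_function_dist_continuous[OF growth])
  \<comment> \<open>The model inequality gives \<open>f + \<omega> \<ge> g\<close>, and minimality
    of \<open>z\<close> bounds \<open>g\<close> plus the \<open>C\<close> term below by
    \<open>g z\<close>.\<close>
  moreover have "ereal m \<le> G y" for y
    using model_cases[of y] min[of y] m by (auto simp: G_def)
  \<comment> \<open>One \<open>\<omega>\<close> is the term added in \<open>G\<close>, the other is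
    the model error at \<open>z\<close>; hence the factor 2 in the radius.\<close>
  moreover have "G z \<le> ereal (m + 2 * \<omega> (dist x z))"
    using b by (simp add: G_def)
  moreover have "0 \<le> \<omega>' (dist x z)"
    using growth_function_nonneg[OF growth] by simp
  \<comment> \<open>Since \<open>\<omega>'\<close> is positive away from 0, this case forces
    \<open>z = x\<close>: it is the convention 0/0 = 0.\<close>
  moreover have "2 * \<omega> (dist x z) = 0" if "\<omega>' (dist x z) = 0"
    using growth that by (cases "x = z") (auto simp: growth_function_def zero_less_dist_iff less_le)
  ultimately obtain y where y: "dist z y \<le> 2 * \<omega> (dist x z) / \<omega>' (dist x z)" "G y \<le> G z"
    and ymin: "\<forall>u. G y \<le> G u + ereal (\<omega>' (dist x z) * dist y u)"
    by (rule Ekeland_near_minimizer)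
  have f_le: "f y \<le> f z + ereal (\<omega> (dist x z))"
  proof -
    have "0 \<le> \<omega> (dist x y) + C * dist z y"
      using growth_function_nonneg[OF growth] C by simp
    then have "f y \<le> G y" unfolding G_def using add_left_mono[of 0 _ "f y"] by fastforce
    then show ?thesis using y(2) by (simp add: G_def)
  qed
  then obtain a where a: "f y = ereal a"
    using model_cases[of y] b by auto
  have "slope f y \<le> ereal (C + \<omega>' (dist x z) + \<omega>' (dist x y))"
  proof (rule slope_le)
    show "\<bar>f y\<bar> \<noteq> \<infinity>" using a by simp
    show "0 \<le> C + \<omega>' (dist x z) + \<omega>' (dist x y)"
      using growth_function_nonneg[OF growth] C by simp
    fix e :: real assume "0 < e"
    from growth_function_dist_increment[OF growth this, of x y]
    show "\<forall>\<^sub>F u in at y. f y \<le> f u + ereal ((C + \<omega>' (dist x z) + \<omega>' (dist x y) + e) * dist y u)"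
    proof eventually_elim
      case (elim u)
      \<comment> \<open>The \<open>C\<close> term is Lipschitz with no error, so the slack
        \<open>e\<close> is spent on \<open>\<omega>\<close> alone.\<close>
      have "C * dist z u \<le> C * dist z y + C * dist y u"
        using C dist_triangle[of z u y] by (simp add: mult_left_mono flip: distrib_left)
      then show ?case
        using elim ymin[rule_format, of u] a model_cases[of u] by (auto simp: G_def algebra_simps)
    qed
  qed
  then show ?thesis using that[of y] y(1) f_le by simp
qed

theorem corollary5p4:
  fixes f fx :: "'a::complete_space \<Rightarrow> ereal"
    and \<omega> \<omega>' :: "real \<Rightarrow> real"
    and x :: 'a and c :: real
  assumes "closed_function f"
    and "\<bar>f x\<bar> \<noteq> \<infinity>"
    and "closed_function fx"
    and "growth_function \<omega> \<omega>'"
    and "model_at \<omega> f x fx"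
    and "c > 0"
  defines "\<Delta> \<equiv> model_improvement f x fx"
  shows "\<exists>z xhat.
      ereal (dist x z) \<le> ereal (inverse c) * ereal_sqrt \<Delta> \<and>
      dist z xhat \<le> 2 * (\<omega> (dist z x) / \<omega>' (dist z x)) \<and>
      f xhat \<le> f x + ereal (2 * \<omega> (dist z x)) \<and>
      slope f xhat \<le> ereal c * ereal_sqrt \<Delta> + ereal (\<omega>' (dist z x)) + ereal (\<omega>' (dist xhat x))"
proof -
  have zero: "\<omega> 0 = 0" "\<omega>' 0 = 0" using assms(4) by (auto simp: growth_function_def)
  obtain a where a: "f x = ereal a" using assms(2) by (cases "f x") auto
  have model: "(fx y = \<infinity> \<and> f y = \<infinity>) \<or>
      (\<bar>fx y\<bar> \<noteq> \<infinity> \<and> \<bar>f y\<bar> \<noteq> \<infinity> \<and> \<bar>fx y - f y\<bar> \<le> ereal (\<omega> (dist x y)))" for y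
    using assms(5) by (simp add: model_at_def)
  \<comment> \<open>The model is exact at \<open>x\<close> because
    \<open>\<omega> 0 = 0\<close>.\<close>
  have ax: "fx x = ereal a" using model[of x] a zero by (cases "fx x") auto
  let ?I = "INF y. fx y"
  have Ix: "?I \<le> ereal a" using ax by (metis INF_lower UNIV_I)
  show ?thesis
  proof (cases "?I = -\<infinity>")
    case True
    then have "\<Delta> = \<infinity>" by (simp add: \<Delta>_def model_improvement_def a)
    \<comment> \<open>As \<open>c\<close> is positive, the first and last right-hand sides are
      infinite; the other two bounds hold at distance 0.\<close>
    then show ?thesis using assms(6) zero
      by (intro exI[of _ x]) (auto simp: ereal_sqrt_def)
  next
    case False
    then obtain m where m: "?I = ereal m" using Ix by (cases ?I) auto
    have bound: "ereal m \<le> fx y" for y using m by (metis INF_lower UNIV_I)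
    have ma: "m \<le> a" using m Ix by simp
    \<comment> \<open>The gap of \<open>fx x\<close> above the infimum is \<open>a - m\<close>, so
      this parameter gives the radius \<open>(a - m) / C = sqrt (a - m) / c\<close>. For
      \<open>a = m\<close> both sides are 0.\<close>
    define C where "C = c * sqrt (a - m)"
    have sqrt: "ereal_sqrt \<Delta> = ereal (sqrt (a - m))"
      by (simp add: \<Delta>_def model_improvement_def a m ereal_sqrt_def)
    have f_lsc: "lower_semicontinuous f" using assms(1) by (simp add: closed_function_def)
    have "lower_semicontinuous fx" using assms(3) by (simp add: closed_function_def)
    moreover have "fx x \<le> ereal (m + (a - m))" using ax by simp
    moreover have C0: "0 \<le> C" using assms(6) ma by (simp add: C_def)
    moreover have "a - m = 0" if "C = 0" using that assms(6) by (simp add: C_def)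
    ultimately obtain z where z: "dist x z \<le> (a - m) / C" "fx z \<le> fx x"
      and zmin: "\<forall>y. fx z \<le> fx y + ereal (C * dist z y)"
      by (rule Ekeland_near_minimizer[OF _ bound])
    have "fx z \<noteq> \<infinity>" using z(2) ax by auto
    then obtain y where y: "dist z y \<le> 2 * (\<omega> (dist x z) / \<omega>' (dist x z))"
      "f y \<le> f z + ereal (\<omega> (dist x z))"
      "slope f y \<le> ereal (C + \<omega>' (dist x z) + \<omega>' (dist x y))"
      using near_stationary_point_of_model_minimizer[OF f_lsc assms(4,5) _ C0 zmin[rule_format]]
      by blast
    have "(a - m) / C = inverse c * sqrt (a - m)"
      using ma by (simp add: C_def divide_inverse real_div_sqrt flip: mult.assoc)
        (metis divide_inverse mult.commute mult.assoc real_div_sqrt diff_ge_0_iff_ge)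
    then have near: "ereal (dist x z) \<le> ereal (inverse c) * ereal_sqrt \<Delta>"
      using z(1) sqrt by simp
    \<comment> \<open>This costs one model error at \<open>z\<close>; the passage from
      \<open>z\<close> to \<open>y\<close> costs the second \<open>\<omega>\<close>.\<close>
    have "f z \<le> f x + ereal (\<omega> (dist x z))"
      using model[of z] z(2) ax a by (cases "f z"; cases "fx z") auto
    then have "f y \<le> f x + ereal (2 * \<omega> (dist x z))"
      using y(2) a by (cases "f y"; cases "f z") auto
    then show ?thesis
      using near y(1,3) sqrt
      by (intro exI[of _ z] exI[of _ y]) (simp add: C_def dist_commute)
  qed
qed

end
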